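(* For all $L\in\mathbf N$, $$\sum_{k=0}^L (-q)_{L-k}\,q^{(L+1)k}\begin{bmatrix} L\\ k\end{bmatrix}_q=\sum_{j=-\infty}^\infty (-1)^j q^{3j^2+j}\begin{bmatrix} 2L+1\\ L-3j\end{bmatrix}_q .$$
   Context: $\mathbf N$ denotes the set of nonnegative integers. For $m\in\mathbf N$, $(a)_m=(a;q)_m=\prod_{j=0}^{m-1}(1-aq^j)$, so $(q)_m=\prod_{j=1}^m(1-q^j)$ and $(-q)_m=\prod_{j=1}^m(1+q^j)$, with $(a)_0=1$. The $q$-binomial coefficient is $\begin{bmatrix} m+n\\ m\end{bmatrix}_q=\frac{(q)_{m+n}}{(q)_m(q)_n}$ if $m,n\in\mathbf N$, and it is $0$ otherwise (so $\begin{bmatrix} A\\ B\end{bmatrix}_q=0$ unless $0\le B\le A$). *)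

theory Defs
  imports Complex_Main "HOL-Library.Groups_Big_Fun"
begin

text \<open>
  The base \<open>q\<close> is an element of an arbitrary field. Taking the field to be a field of rational
  functions and \<open>q\<close> its variable gives the reading of \<open>q\<close> as an indeterminate.
\<close>

definition qpoch :: "'a::field \<Rightarrow> 'a \<Rightarrow> nat \<Rightarrow> 'a" where
  "qpoch a q m = (\<Prod>j<m. 1 - a * q ^ j)"

text \<open>
  The arguments are integers because the lower one may be negative. The quotient is meaningful
  when no \<open>1 - q ^ i\<close> with \<open>i > 0\<close> vanishes.
\<close>

definition qbinom :: "'a::field \<Rightarrow> int \<Rightarrow> int \<Rightarrow> 'a" where
  "qbinom q A B =
     (if 0 \<le> B \<and> B \<le> A
      then qpoch q q (nat A) / (qpoch q q (nat B) * qpoch q q (nat (A - B)))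
      else 0)"

text \<open>
  \<^const>\<open>Sum_any\<close> returns \<open>0\<close> on functions of infinite support; the following fact rules this
  out for bilateral sums of the shape used here.
\<close>

lemma finite_support_qbinom:
  fixes c :: "int \<Rightarrow> 'a::field" and L :: nat
  shows "finite {j::int. c j * qbinom q (2 * int L + 1) (int L - 3 * j) \<noteq> 0}"
proof (rule finite_subset)
  show "{j::int. c j * qbinom q (2 * int L + 1) (int L - 3 * j) \<noteq> 0}
          \<subseteq> {- int L - 1..int L}"
    by (auto simp: qbinom_def split: if_splits)
qed simp

end

theory Submission imports Defs begin

text \<open>
  Put \<open>T n a b = (\<Sum>j. (-1)^j q^(3j^2+bj) [n, a-3j])\<close>, so that the right-hand side is
  \<open>P L = T (2L+1) L 1\<close>. The two \<open>q\<close>-Pascal rules express \<open>T (n+1)\<close> through \<open>T n\<close>, and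
  \<open>j \<mapsto> j + 1\<close> identifies \<open>(a, b)\<close> with \<open>(a - 3, b + 6)\<close> up to a factor. Individually the sums
  that arise do not close up under \<open>L \<mapsto> L + 1\<close>, but the combination
  \<open>G L = q T (2L+1) (L-1) 4 + T (2L+1) (L+1) (-2)\<close> does together with \<open>P\<close>: expanding
  \<open>T (2L+2) (L-1) 4\<close> by both Pascal rules gives the missing relation. With \<open>x = q^(L+1)\<close>,
  \<open>P (L+1) = (1 + x^2) P L + x G L\<close> and \<open>G (L+1) = 2 x P L + x^2 G L\<close>.

  The left-hand side is \<open>S L x\<close>, where \<open>S L z = (\<Sum>k. (-q)_(L-k) z^k [L, k])\<close>. The rules
  \<open>S L (qz) = S L z - z (1 - q^L) S (L-1) z\<close> and \<open>S (L+1) z = (z + q^(L+1)) S L z + S L (qz)\<close>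
  show that \<open>S L x\<close> and \<open>S L x - (1 - q^L) S (L-1) x\<close> obey the same recurrence.
  The exponents \<open>b\<close> may be negative, so \<open>q = 0\<close> is treated separately.
\<close>

section \<open>q-binomial coefficients and the two q-Pascal rules\<close>

lemma one_minus_power_nonzero:
  fixes q :: "'a::field"
  assumes "\<And>i::nat. i > 0 \<Longrightarrow> q ^ i \<noteq> 1"
  shows "1 - q * q ^ i \<noteq> 0"
  using assms[of "Suc i"] by simp

lemma qpoch_0 [simp]: "qpoch a q 0 = 1"
  by (simp add: qpoch_def)

lemma qpoch_Suc: "qpoch a q (Suc m) = qpoch a q m * (1 - a * q ^ m)"
  by (simp add: qpoch_def)

lemma qpoch_self_nonzero:
  fixes q :: "'a::field"
  assumes "\<And>i::nat. i > 0 \<Longrightarrow> q ^ i \<noteq> 1"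
  shows "qpoch q q m \<noteq> 0"
  unfolding qpoch_def using one_minus_power_nonzero[OF assms] by simp

lemma qbinom_sym: "qbinom q n (n - m) = qbinom q n m"
  by (auto simp: qbinom_def mult.commute)

lemma qbinom_eq_0: "m < 0 \<or> m > n \<Longrightarrow> qbinom q n m = 0"
  by (auto simp: qbinom_def)

lemma qbinom_nat:
  "k \<le> n \<Longrightarrow> qbinom q (int n) (int k) = qpoch q q n / (qpoch q q k * qpoch q q (n - k))"
  by (simp add: qbinom_def nat_diff_distrib)

lemma qbinom_0_right:
  assumes "\<And>i::nat. i > 0 \<Longrightarrow> q ^ i \<noteq> 1"
  shows "qbinom q (int n) 0 = 1"
  using qpoch_self_nonzero[OF assms] by (simp add: qbinom_def)

lemma qbinom_self:
  assumes "\<And>i::nat. i > 0 \<Longrightarrow> q ^ i \<noteq> 1"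
  shows "qbinom q (int n) (int n) = 1"
  using qpoch_self_nonzero[OF assms] by (simp add: qbinom_def)

lemma qbinom_pascal:
  fixes q :: "'a::field" and m :: int
  assumes q: "\<And>i::nat. i > 0 \<Longrightarrow> q ^ i \<noteq> 1"
  shows "qbinom q (int n + 1) m = qbinom q (int n) m + q powi (int n + 1 - m) * qbinom q (int n) (m - 1)"
proof -
  consider "m < 0 \<or> m > int n + 1" | "m = 0" | "m = int (Suc n)" | "1 \<le> m" "m \<le> int n"
    by linarith
  then show ?thesis
  proof cases
    case 1
    then show ?thesis by (auto simp: qbinom_eq_0)
  next
    case 2
    then show ?thesis
      using qbinom_0_right[OF q, of n] qbinom_0_right[OF q, of "Suc n"]
      by (simp add: qbinom_eq_0 add.commute)
  next
    case 3
    then show ?thesis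
      using qbinom_self[OF q, of n] qbinom_self[OF q, of "Suc n"]
      by (simp add: qbinom_eq_0 add.commute)
  next
    case 4
    \<comment> \<open>In the interior case n = k + r + 1 with natural k and r, so the integer power
      becomes q^(r+1) and the rule reduces to an identity of q-factorials.\<close>
    define k where "k = nat (m - 1)"
    define r where "r = nat (int n - m)"
    have m: "m = int (Suc k)" and n: "n = Suc (k + r)"
      using 4 by (auto simp: k_def r_def)
    have e: "int n + 1 - m = int (Suc r)" "m - 1 = int k" "int n + 1 = int (Suc n)"
      using m n by auto
    have "qbinom q (int (Suc n)) (int (Suc k))
        = qbinom q (int n) (int (Suc k)) + q ^ Suc r * qbinom q (int n) (int k)"
      using qpoch_self_nonzero[OF q] one_minus_power_nonzero[OF q]
      by (simp add: n qbinom_nat qpoch_Suc Suc_diff_le divide_simps del: of_nat_Suc of_nat_add)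
         (simp add: algebra_simps power_add)
    then show ?thesis
      unfolding e(1,2) unfolding e(3) m by (simp only: power_int_of_nat)
  qed
qed

text \<open>The reflection m -> n + 1 - m carries the first Pascal rule to this one.\<close>

lemma qbinom_pascal':
  fixes q :: "'a::field" and m :: int
  assumes q: "\<And>i::nat. i > 0 \<Longrightarrow> q ^ i \<noteq> 1"
  shows "qbinom q (int n + 1) m = qbinom q (int n) (m - 1) + q powi m * qbinom q (int n) m"
  using qbinom_pascal[OF q, of n "int n + 1 - m"]
    qbinom_sym[of q "int n + 1" m] qbinom_sym[of q "int n" m] qbinom_sym[of q "int n" "m - 1"]
  by (simp add: algebra_simps)

section \<open>Bilateral sums with a quadratic exponent\<close>

definition theta_sum :: "'a::field \<Rightarrow> nat \<Rightarrow> int \<Rightarrow> int \<Rightarrow> 'a" where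
  "theta_sum q n a b =
     Sum_any (\<lambda>j::int. (- 1) powi j * q powi (3 * j\<^sup>2 + b * j) * qbinom q (int n) (a - 3 * j))"

lemma finite_support_theta_sum:
  fixes c :: "int \<Rightarrow> 'a::field"
  shows "finite {j::int. c j * qbinom q (int n) (a - 3 * j) \<noteq> 0}"
proof (rule finite_subset)
  show "{j::int. c j * qbinom q (int n) (a - 3 * j) \<noteq> 0} \<subseteq> {- \<bar>a\<bar> - int n..\<bar>a\<bar> + int n}"
    by (auto simp: qbinom_def split: if_splits)
qed simp

text \<open>Common core of both Pascal rules for the sums: a weight q^(dj) merges into the linear
  part of the exponent, turning b into b + d. The Pascal rules use d = 3 and d = -3.\<close>

lemma theta_sum_linear:
  fixes q c :: "'a::field"
  assumes "\<And>j::int. qbinom q (int n) (a - 3 * j)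
     = qbinom q (int n') (a' - 3 * j) + c * q powi (d * j) * qbinom q (int n'') (a'' - 3 * j)"
    and "q \<noteq> 0"
  shows "theta_sum q n a b = theta_sum q n' a' b + c * theta_sum q n'' a'' (b + d)"
proof -
  let ?f = "\<lambda>j::int. (- 1) powi j * q powi (3 * j\<^sup>2 + b * j) * qbinom q (int n') (a' - 3 * j)"
  let ?g = "\<lambda>j::int. (- 1) powi j * q powi (3 * j\<^sup>2 + (b + d) * j) * qbinom q (int n'') (a'' - 3 * j)"
  have "theta_sum q n a b = Sum_any (\<lambda>j. ?f j + c * ?g j)"
    unfolding theta_sum_def assms(1)
    by (intro arg_cong[where f = Sum_any] ext)
       (simp add: assms(2) power_int_add algebra_simps)
  also have "\<dots> = Sum_any ?f + Sum_any (\<lambda>j. c * ?g j)"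
    using finite_support_theta_sum[of "\<lambda>j. c * ((- 1) powi j * q powi (3 * j\<^sup>2 + (b + d) * j))"]
    by (intro Sum_any.distrib finite_support_theta_sum) (simp add: mult.assoc)
  also have "Sum_any (\<lambda>j. c * ?g j) = c * Sum_any ?g"
    by (rule Sum_any_right_distrib[OF finite_support_theta_sum, symmetric])
  finally show ?thesis
    by (simp add: theta_sum_def)
qed

lemma theta_sum_pascal:
  fixes q :: "'a::field"
  assumes q: "\<And>i::nat. i > 0 \<Longrightarrow> q ^ i \<noteq> 1" and "q \<noteq> 0"
  shows "theta_sum q (Suc n) a b
       = theta_sum q n a b + q powi (int n + 1 - a) * theta_sum q n (a - 1) (b + 3)"
proof (rule theta_sum_linear[OF _ \<open>q \<noteq> 0\<close>])
  fix j :: int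
  show "qbinom q (int (Suc n)) (a - 3 * j) = qbinom q (int n) (a - 3 * j)
      + q powi (int n + 1 - a) * q powi (3 * j) * qbinom q (int n) (a - 1 - 3 * j)"
    using qbinom_pascal[OF q, of n "a - 3 * j"] \<open>q \<noteq> 0\<close>
    by (simp add: power_int_add[symmetric] algebra_simps)
qed

lemma theta_sum_pascal':
  fixes q :: "'a::field"
  assumes q: "\<And>i::nat. i > 0 \<Longrightarrow> q ^ i \<noteq> 1" and "q \<noteq> 0"
  shows "theta_sum q (Suc n) a b
       = theta_sum q n (a - 1) b + q powi a * theta_sum q n a (b - 3)"
proof -
  have "theta_sum q (Suc n) a b = theta_sum q n (a - 1) b + q powi a * theta_sum q n a (b + (- 3))"
  proof (rule theta_sum_linear[OF _ \<open>q \<noteq> 0\<close>])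
    fix j :: int
    show "qbinom q (int (Suc n)) (a - 3 * j) = qbinom q (int n) (a - 1 - 3 * j)
        + q powi a * q powi (- 3 * j) * qbinom q (int n) (a - 3 * j)"
      using qbinom_pascal'[OF q, of n "a - 3 * j"] \<open>q \<noteq> 0\<close>
      by (simp add: power_int_add[symmetric] algebra_simps)
  qed
  then show ?thesis by simp
qed

lemma theta_sum_shift:
  fixes q :: "'a::field"
  assumes "q \<noteq> 0"
  shows "theta_sum q n a b = - (q powi (3 + b)) * theta_sum q n (a - 3) (b + 6)"
proof -
  let ?g = "\<lambda>j::int. (- 1) powi j * q powi (3 * j\<^sup>2 + (b + 6) * j) * qbinom q (int n) (a - 3 - 3 * j)"
  have "theta_sum q n a b = Sum_any (\<lambda>j. - (q powi (3 + b)) * ?g j)"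
    unfolding theta_sum_def
  proof (rule Sum_any.reindex_cong[of "\<lambda>j. j + 1"])
    show "bij (\<lambda>j::int. j + 1)"
      by (rule bijI') (auto intro: exI[of _ "_ - 1"])
    show "(\<lambda>j. (- 1) powi j * q powi (3 * j\<^sup>2 + b * j) * qbinom q (int n) (a - 3 * j)) \<circ> (\<lambda>j. j + 1)
        = (\<lambda>j. - (q powi (3 + b)) * ?g j)"
    proof
      fix j :: int
      have "3 * (j + 1)\<^sup>2 + b * (j + 1) = (3 + b) + (3 * j\<^sup>2 + (b + 6) * j)"
        by (simp add: power2_eq_square algebra_simps)
      then have "q powi (3 * (j + 1)\<^sup>2 + b * (j + 1)) = q powi (3 + b) * q powi (3 * j\<^sup>2 + (b + 6) * j)"
        using assms by (simp only: power_int_add simp_thms)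
      moreover have "(- 1 :: 'a) powi (j + 1) = - ((- 1) powi j)"
        by (simp add: power_int_add)
      moreover have "a - 3 * (j + 1) = a - 3 - 3 * j"
        by simp
      ultimately show "((\<lambda>j. (- 1) powi j * q powi (3 * j\<^sup>2 + b * j) * qbinom q (int n) (a - 3 * j)) \<circ> (\<lambda>j. j + 1)) j
          = - (q powi (3 + b)) * ?g j"
        by (simp add: algebra_simps)
    qed
  qed
  also have "\<dots> = - (q powi (3 + b)) * Sum_any ?g"
    by (rule Sum_any_right_distrib[OF finite_support_theta_sum, symmetric])
  finally show ?thesis
    by (simp add: theta_sum_def)
qed

text \<open>Serves the initial values at L = 0, where 2L + 1 = 1. Since [1, m] vanishes unless m is
  0 or 1, only j = 0 survives.\<close>

lemma theta_sum_1:
  fixes a b :: int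
  assumes "\<And>j. j \<noteq> 0 \<Longrightarrow> a - 3 * j \<noteq> 0 \<and> a - 3 * j \<noteq> 1"
  shows "theta_sum q 1 a b = qbinom q 1 a"
proof -
  have "theta_sum q 1 a b
      = (\<Sum>j\<in>{0::int}. (- 1) powi j * q powi (3 * j\<^sup>2 + b * j) * qbinom q (int 1) (a - 3 * j))"
    unfolding theta_sum_def
  proof (rule Sum_any.expand_superset)
    have "qbinom q 1 (a - 3 * j) = 0" if "j \<noteq> 0" for j
      using assms[OF that] by (intro qbinom_eq_0) linarith
    then show "{j. (- 1) powi j * q powi (3 * j\<^sup>2 + b * j) * qbinom q (int 1) (a - 3 * j) \<noteq> 0} \<subseteq> {0}"
      by auto
  qed simp
  then show ?thesis by simp
qed

section \<open>Sequences for the two sides, and the recurrence of the right-hand pair\<close>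

definition right_main :: "'a::field \<Rightarrow> nat \<Rightarrow> 'a" where
  "right_main q L = theta_sum q (2 * L + 1) (int L) 1"

definition right_aux :: "'a::field \<Rightarrow> nat \<Rightarrow> 'a" where
  "right_aux q L =
     q * theta_sum q (2 * L + 1) (int L - 1) 4 + theta_sum q (2 * L + 1) (int L + 1) (- 2)"

definition left_sum :: "'a::field \<Rightarrow> nat \<Rightarrow> 'a \<Rightarrow> 'a" where
  "left_sum q L z = (\<Sum>k=0..L. qpoch (- q) q (L - k) * z ^ k * qbinom q (int L) (int k))"

definition left_main :: "'a::field \<Rightarrow> nat \<Rightarrow> 'a" where
  "left_main q L = left_sum q L (q ^ (L + 1))"

text \<open>For \<open>L = 0\<close> the truncated \<open>L - 1\<close> is harmless, since its coefficient vanishes.\<close>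

definition left_aux :: "'a::field \<Rightarrow> nat \<Rightarrow> 'a" where
  "left_aux q L = left_main q L - (1 - q ^ L) * left_sum q (L - 1) (q ^ (L + 1))"

context
  fixes q :: "'a::field"
  assumes q: "\<And>i::nat. i > 0 \<Longrightarrow> q ^ i \<noteq> 1"
begin

text \<open>Passing from L to L + 1 raises 2L + 1 by two, so Pascal is applied twice, through the
  levels \<open>T1\<close> and \<open>T2\<close>. Besides \<open>P\<close>, \<open>X\<close>,
  \<open>Y\<close> this produces \<open>Z\<close> and \<open>W\<close>, which occur only as
  \<open>y * (Z + W)\<close> and can be eliminated.\<close>

lemma right_recurrence:
  fixes L :: nat
  assumes "q \<noteq> 0"
  defines "x \<equiv> q ^ (L + 1)"
  shows "right_main q (Suc L) = (1 + x\<^sup>2) * right_main q L + x * right_aux q L"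
    and "right_aux q (Suc L) = 2 * x * right_main q L + x\<^sup>2 * right_aux q L"
proof -
  define T where "T = theta_sum q (2 * L + 1)"
  define T1 where "T1 = theta_sum q (Suc (2 * L + 1))"
  define T2 where "T2 = theta_sum q (Suc (Suc (2 * L + 1)))"
  define P X Y Z W where "P = T (int L) 1" and "X = T (int L - 1) 4" and "Y = T (int L + 1) (- 2)"
    and "Z = T (int L - 1) 1" and "W = T (int L + 1) 1"
  define y where "y = q ^ L"
  have x: "x = q * y" by (simp add: x_def y_def)
  have pw: "q powi (int L + 1) = q * y" "q powi int L = y" "q powi (int L + 2) = q ^ 2 * y"
    "q powi (int L + 3) = q ^ 3 * y" "q powi (int L - 1) = y / q"
    using assms(1) by (simp_all add: y_def power_int_add power_int_diff mult.commute)
  note A1 = theta_sum_pascal[OF q assms(1), of "2 * L + 1", folded T_def T1_def]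
    and B1 = theta_sum_pascal'[OF q assms(1), of "2 * L + 1", folded T_def T1_def]
    and A2 = theta_sum_pascal[OF q assms(1), of "Suc (2 * L + 1)", folded T1_def T2_def]
    and B2 = theta_sum_pascal'[OF q assms(1), of "Suc (2 * L + 1)", folded T1_def T2_def]
    and J = theta_sum_shift[OF assms(1), of "2 * L + 1", folded T_def]
  \<comment> \<open>The index shift brings the arguments produced by Pascal back to
    \<open>X\<close>, \<open>Y\<close> and \<open>W\<close>.\<close>
  have Y': "T (int L - 2) 4 = - Y / q"
    using J[of "int L + 1" "- 2"] assms(1) by (simp add: Y_def field_simps)
  have X': "T (int L + 2) (- 2) = - q * X"
    using J[of "int L + 2" "- 2"] by (simp add: X_def)
  have W': "T (int L - 2) 7 = - W / q ^ 4"
    using J[of "int L + 1" 1] assms(1) by (simp add: W_def field_simps)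
  have a: "T1 (int L) 1 = P + q ^ 2 * y * X"
    using A1[of "int L" 1] by (simp add: P_def X_def pw)
  have b: "T1 (int L + 1) (- 2) = Y + q * y * P"
    using A1[of "int L + 1" "- 2"] by (simp add: P_def Y_def pw)
  have c: "T1 (int L - 1) 4 = - Y / q + y / q * Z"
    using B1[of "int L - 1" 4] Y' by (simp add: Z_def pw)
  have c': "T1 (int L - 1) 4 = X - y / q * W"
    using A1[of "int L - 1" 4] W' assms(1) by (simp add: X_def pw field_simps eval_nat_numeral)
  have d: "T1 (int L + 2) (- 2) = - q * X + y * W"
    using A1[of "int L + 2" "- 2"] X' by (simp add: W_def y_def pw add.commute)
  have e: "T1 (int L + 1) 1 = P + q * y * Y"
    using B1[of "int L + 1" 1] by (simp add: P_def Y_def pw)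
  \<comment> \<open>Equates the two Pascal expansions \<open>c\<close> and \<open>c'\<close> of the
    same sum.\<close>
  have ZW: "y * (Z + W) = q * X + Y"
    using c c' assms(1) by (simp add: field_simps)
  have main: "right_main q L = P" "right_main q (Suc L) = T2 (int L + 1) 1"
    and aux: "right_aux q L = q * X + Y" "right_aux q (Suc L) = q * T2 (int L) 4 + T2 (int L + 2) (- 2)"
    by (simp_all add: right_main_def right_aux_def P_def X_def Y_def T_def T2_def add.commute)
  have "T2 (int L + 1) 1 = P + q ^ 2 * y * X + q * y * (Y + q * y * P)"
    using B2[of "int L + 1" 1] a b by (simp add: pw)
  then show "right_main q (Suc L) = (1 + x\<^sup>2) * right_main q L + x * right_aux q L"
    unfolding main aux x by (simp add: algebra_simps power2_eq_square)
  have "T2 (int L) 4 = - Y / q + y / q * Z + y * (P + q ^ 2 * y * X)"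
    using B2[of "int L" 4] a c by (simp add: pw y_def)
  then have T2_X: "q * T2 (int L) 4 = - Y + y * Z + q * y * (P + q ^ 2 * y * X)"
    using assms(1) by (simp add: field_simps)
  have T2_Y: "T2 (int L + 2) (- 2) = - q * X + y * W + q * y * (P + q * y * Y)"
    using A2[of "int L + 2" "- 2"] d e[unfolded add.commute[of "int L" 1]] by (simp add: pw)
  \<comment> \<open>Grouped so that the first two terms cancel by \<open>ZW\<close>.\<close>
  have "right_aux q (Suc L)
      = y * (Z + W) - (q * X + Y) + 2 * x * P + x\<^sup>2 * (q * X + Y)"
    unfolding aux T2_X T2_Y x by (simp add: algebra_simps power2_eq_square)
  then show "right_aux q (Suc L) = 2 * x * right_main q L + x\<^sup>2 * right_aux q L"
    by (simp add: ZW main aux)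
qed

lemma right_0: "right_main q 0 = 1" "right_aux q 0 = 1"
proof -
  have "theta_sum q 1 0 1 = qbinom q 1 0" "theta_sum q 1 (- 1) 4 = qbinom q 1 (- 1)"
    "theta_sum q 1 1 (- 2) = qbinom q 1 1"
    by (intro theta_sum_1; presburger)+
  then show "right_main q 0 = 1" "right_aux q 0 = 1"
    using qbinom_0_right[OF q, of 1] qbinom_self[OF q, of 1]
    by (simp_all add: right_main_def right_aux_def qbinom_eq_0)
qed

section \<open>Recurrence of the left-hand pair\<close>

lemma qbinom_absorb:
  "(1 - q ^ Suc k) * qbinom q (int (Suc L)) (int (Suc k)) = (1 - q ^ Suc L) * qbinom q (int L) (int k)"
  if "k \<le> L"
  using that qpoch_self_nonzero[OF q] one_minus_power_nonzero[OF q]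
  by (simp add: qbinom_nat qpoch_Suc divide_simps del: of_nat_Suc)

text \<open>Replacing z by qz changes the k-th term by the factor q^k, and absorption turns (1 -
  q^k) [L, k] into (1 - q^L) [L-1, k-1]. For L = 0 the factor 1 - q^L vanishes.\<close>

lemma left_sum_shift:
  "left_sum q L (q * z) = left_sum q L z - z * ((1 - q ^ L) * left_sum q (L - 1) z)"
proof (cases L)
  case 0
  then show ?thesis by (simp add: left_sum_def)
next
  case (Suc M)
  have "left_sum q L z - left_sum q L (q * z)
      = (\<Sum>k=0..Suc M. qpoch (- q) q (Suc M - k) * z ^ k * ((1 - q ^ k) * qbinom q (int (Suc M)) (int k)))"
    by (simp only: left_sum_def Suc sum_subtractf[symmetric])
       (intro sum.cong refl; simp add: algebra_simps power_mult_distrib)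
  also have "\<dots> = (\<Sum>k=0..M. qpoch (- q) q (M - k) * z ^ Suc k
      * ((1 - q ^ Suc k) * qbinom q (int (Suc M)) (int (Suc k))))"
    by (subst sum.atLeast0_atMost_Suc_shift) (simp del: power_Suc of_nat_Suc)
  also have "\<dots> = (\<Sum>k=0..M. z * ((1 - q ^ Suc M) * (qpoch (- q) q (M - k) * z ^ k * qbinom q (int M) (int k))))"
    by (intro sum.cong refl) (simp only: qbinom_absorb atLeastAtMost_iff; simp add: mult_ac)
  also have "\<dots> = z * ((1 - q ^ L) * left_sum q (L - 1) z)"
    by (simp only: left_sum_def Suc sum_distrib_left[symmetric] diff_Suc_1)
  finally show ?thesis by (simp add: algebra_simps)
qed

text \<open>By the second Pascal rule, the part with [L, k-1] gives the summand with factor z. In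
  the part with q^k [L, k], the last factor 1 + q^(L+1-k) of (-q)_(L+1-k) splits the sum: q^k
  q^(L+1-k) = q^(L+1) is free of k, and the bare q^k replaces z by qz.\<close>

lemma left_sum_Suc:
  "left_sum q (Suc L) z = (z + q ^ Suc L) * left_sum q L z + left_sum q L (q * z)"
proof -
  have "left_sum q (Suc L) z
      = (\<Sum>k=0..Suc L. qpoch (- q) q (Suc L - k) * z ^ k * qbinom q (int L) (int k - 1))
        + (\<Sum>k=0..Suc L. qpoch (- q) q (Suc L - k) * z ^ k * (q ^ k * qbinom q (int L) (int k)))"
    unfolding left_sum_def sum.distrib[symmetric]
    using qbinom_pascal'[OF q, of L]
    by (intro sum.cong refl) (simp add: add.commute algebra_simps)
  also have "(\<Sum>k=0..Suc L. qpoch (- q) q (Suc L - k) * z ^ k * qbinom q (int L) (int k - 1))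
      = (\<Sum>k=0..L. z * (qpoch (- q) q (L - k) * z ^ k * qbinom q (int L) (int k)))"
    by (subst sum.atLeast0_atMost_Suc_shift) (simp add: qbinom_eq_0 mult_ac)
  also have "\<dots> = z * left_sum q L z"
    by (simp only: left_sum_def sum_distrib_left)
  also have "(\<Sum>k=0..Suc L. qpoch (- q) q (Suc L - k) * z ^ k * (q ^ k * qbinom q (int L) (int k)))
      = (\<Sum>k=0..L. qpoch (- q) q (Suc L - k) * z ^ k * (q ^ k * qbinom q (int L) (int k)))"
    by (simp add: qbinom_eq_0)
  also have "\<dots> = (\<Sum>k=0..L. q ^ Suc L * (qpoch (- q) q (L - k) * z ^ k * qbinom q (int L) (int k))
      + qpoch (- q) q (L - k) * (q * z) ^ k * qbinom q (int L) (int k))"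
  proof (intro sum.cong refl)
    fix k assume "k \<in> {0..L}"
    then have k: "Suc L - k = Suc (L - k)" and e: "q ^ Suc L = q * q ^ (L - k) * q ^ k"
      by (auto simp: power_add[symmetric])
    then show "qpoch (- q) q (Suc L - k) * z ^ k * (q ^ k * qbinom q (int L) (int k))
      = q ^ Suc L * (qpoch (- q) q (L - k) * z ^ k * qbinom q (int L) (int k))
      + qpoch (- q) q (L - k) * (q * z) ^ k * qbinom q (int L) (int k)"
      unfolding k qpoch_Suc e by (simp add: algebra_simps power_mult_distrib)
  qed
  also have "\<dots> = q ^ Suc L * left_sum q L z + left_sum q L (q * z)"
    by (simp only: left_sum_def sum.distrib sum_distrib_left)
  finally show ?thesis by (simp add: algebra_simps)
qed

lemma left_recurrence:
  fixes L :: nat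
  defines "x \<equiv> q ^ (L + 1)"
  shows "left_main q (Suc L) = (1 + x\<^sup>2) * left_main q L + x * left_aux q L"
    and "left_aux q (Suc L) = 2 * x * left_main q L + x\<^sup>2 * left_aux q L"
proof -
  define y where "y = q ^ L"
  have x: "x = q * y" by (simp add: x_def y_def)
  define F H where "F = left_sum q L x" and "H = (1 - y) * left_sum q (L - 1) x"
  have shift: "left_sum q L (q * x) = F - x * H"
    using left_sum_shift[of L x] by (simp add: F_def H_def y_def)
  \<comment> \<open>For L > 0, \<open>left_sum_Suc\<close> at L - 1 is solved for its term at qx;
    for L = 0 both sides vanish because y = 1.\<close>
  have "(1 - y) * left_sum q (L - 1) (q * x) = (1 - y) * F - (x + y) * H"
  proof (cases L)
    case 0
    then show ?thesis by (simp add: y_def H_def)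
  next
    case (Suc M)
    then show ?thesis
      using left_sum_Suc[of M x] by (simp add: F_def H_def y_def algebra_simps)
  qed
  then have shift2: "left_sum q L (q * (q * x)) = F - x * H - q * x * ((1 - y) * F - (x + y) * H)"
    using left_sum_shift[of L "q * x"] shift by (simp add: y_def)
  have main: "left_main q L = F" and aux: "left_aux q L = F - H"
    by (simp_all add: left_aux_def left_main_def F_def H_def x_def y_def)
  \<comment> \<open>The argument belonging to L + 1 is q^(L+2) = qx, hence the values at qx and q^2
    x, which \<open>shift\<close> and \<open>shift2\<close> express by \<open>F\<close> and
    \<open>H\<close>.\<close>
  have "left_main q (Suc L) = (q * x + x) * left_sum q L (q * x) + left_sum q L (q * (q * x))"
    using left_sum_Suc[of L "q * x"] by (simp add: left_main_def x_def)
  also have "\<dots> = (1 + x\<^sup>2) * F + x * (F - H)"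
    unfolding shift shift2 unfolding x by (simp add: algebra_simps power2_eq_square)
  finally have F': "left_main q (Suc L) = (1 + x\<^sup>2) * F + x * (F - H)" .
  then show "left_main q (Suc L) = (1 + x\<^sup>2) * left_main q L + x * left_aux q L"
    by (simp add: main aux)
  have "left_aux q (Suc L) = left_main q (Suc L) - (1 - x) * left_sum q L (q * x)"
    by (simp add: left_aux_def x_def)
  also have "\<dots> = 2 * x * F + x\<^sup>2 * (F - H)"
    unfolding shift F' by (simp add: algebra_simps power2_eq_square)
  finally show "left_aux q (Suc L) = 2 * x * left_main q L + x\<^sup>2 * left_aux q L"
    by (simp add: main aux)
qed

lemma left_0: "left_main q 0 = 1" "left_aux q 0 = 1"
  using qbinom_0_right[OF q, of 0] by (simp_all add: left_aux_def left_main_def left_sum_def)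

section \<open>Comparison of the two sides, and the base q = 0\<close>

lemma left_eq_right:
  assumes "q \<noteq> 0"
  shows "left_main q L = right_main q L \<and> left_aux q L = right_aux q L"
proof (induction L)
  case 0
  then show ?case by (simp add: left_0 right_0)
next
  case (Suc L)
  then show ?case by (simp add: left_recurrence right_recurrence[OF assms])
qed

end

theorem mainTheorem4:
  fixes q :: "'a::field" and L :: nat
  assumes "\<And>i::nat. i > 0 \<Longrightarrow> q ^ i \<noteq> 1"
  shows "(\<Sum>k=0..L. qpoch (- q) q (L - k) * q ^ ((L + 1) * k) * qbinom q (int L) (int k))
       = Sum_any (\<lambda>j::int. (- 1) powi j * q powi (3 * j\<^sup>2 + j)
                             * qbinom q (2 * int L + 1) (int L - 3 * j))"
proof (cases "q = 0")
  case False
  then show ?thesis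
    using left_eq_right[OF assms False, of L]
    by (simp add: left_main_def left_sum_def right_main_def theta_sum_def
        power_mult[symmetric] add.commute del: power_Suc)
next
  case True
  \<comment> \<open>At q = 0 only the terms k = 0 and j = 0 survive, and both equal 1.\<close>
  have one: "qpoch 0 0 m = (1::'a)" for m
    by (simp add: qpoch_def)
  have "(\<Sum>k=0..L. qpoch (- q) q (L - k) * q ^ ((L + 1) * k) * qbinom q (int L) (int k))
      = (\<Sum>k\<in>{0}. qpoch (- q) q (L - k) * q ^ ((L + 1) * k) * qbinom q (int L) (int k))"
    by (rule sum.mono_neutral_right) (auto simp: True)
  moreover have "Sum_any (\<lambda>j::int. (- 1) powi j * q powi (3 * j\<^sup>2 + j)
        * qbinom q (2 * int L + 1) (int L - 3 * j))
      = (\<Sum>j\<in>{0::int}. (- 1) powi j * q powi (3 * j\<^sup>2 + j)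
        * qbinom q (2 * int L + 1) (int L - 3 * j))"
  proof (rule Sum_any.expand_superset)
    \<comment> \<open>The exponent is j (3j + 1), whose only integer root is 0; a nonzero power of 0
      is 0.\<close>
    have "3 * j\<^sup>2 + j \<noteq> 0" if "j \<noteq> 0" for j :: int
    proof
      assume "3 * j\<^sup>2 + j = 0"
      then have "j * (3 * j + 1) = 0" by (simp add: power2_eq_square algebra_simps)
      with that show False by simp
    qed
    then show "{j::int. (- 1) powi j * q powi (3 * j\<^sup>2 + j)
        * qbinom q (2 * int L + 1) (int L - 3 * j) \<noteq> 0} \<subseteq> {0}"
      by (auto simp: True power_int_0_left_if)
  qed simp
  ultimately show ?thesis
    by (simp add: True qbinom_def one)
qed

end
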